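(* Let $n>3$ be odd. The class $\langle L_n\cup I\rangle$ contains exactly one left alternative neutrosophic loop and exactly one right alternative neutrosophic loop, and does not contain any alternative neutrosophic loop.
   Context: For $n>3$ odd and $m<n$ a positive integer with $\gcd(m,n)=\gcd(m-1,n)=1$, the loop $L_n(m)$ is the set $\{e,1,2,\dots,n\}$ with operation: $e\cdot i=i\cdot e=i$ for all $i$; $i\cdot i=e$ for all $i$; and for $i,j\in\{1,\dots,n\}$, $i\neq j$, $i\cdot j$ is the element $s\in\{1,\dots,n\}$ with $s\equiv mj-(m-1)i \pmod n$. The neutrosophic loop $\langle L_n(m)\cup I\rangle$ is the set $\{e,1,\dots,n,eI,1I,\dots,nI\}$ of $2(n+1)$ distinct symbols, with the product of $L_n(m)$ on $\{e,1,\dots,n\}$ and $x\cdot(yI)=(xI)\cdot y=(xI)\cdot(yI)=(x\cdot y)I$ for $x,y\in L_n(m)$. For fixed $n$, $\langle L_n\cup I\rangle$ denotes the collection of all $\langle L_n(m)\cup I\rangle$ with $m$ ranging over the positive integers $m<n$ with $\gcd(m,n)=\gcd(m-1,n)=1$ (different $m$ giving different members). A neutrosophic loop is right alternative if $(xy)y=x(yy)$ for all its elements $x,y$, left alternative if $(xx)y=x(xy)$ for all its elements $x,y$, and alternative if it is both. *)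

theory Defs
  imports "HOL-Algebra.Group" "HOL-Number_Theory.Cong"
begin

datatype loop_elem = E | Num int

text \<open>
  The record type \<open>'a monoid\<close> is used only as a signature (carrier, product, unit); the
  structures below are not associative.
\<close>

fun L_mult :: "int \<Rightarrow> int \<Rightarrow> loop_elem \<Rightarrow> loop_elem \<Rightarrow> loop_elem" where
  "L_mult n m E y = y"
| "L_mult n m x E = x"
| "L_mult n m (Num i) (Num j) =
     (if i = j then E
      else Num (THE s. s \<in> {1..n} \<and> [s = m * j - (m - 1) * i] (mod n)))"

definition L_loop :: "int \<Rightarrow> int \<Rightarrow> loop_elem monoid" where
  "L_loop n m = \<lparr>carrier = insert E (Num ` {1..n}), monoid.mult = L_mult n m, one = E\<rparr>"

text \<open>\<open>Pure x\<close> is the element \<open>x\<close> itself and \<open>Indet x\<close> is the formal symbol \<open>xI\<close>.\<close>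

datatype 'a neut = Pure 'a | Indet 'a

fun neut_mult :: "('a \<Rightarrow> 'a \<Rightarrow> 'a) \<Rightarrow> 'a neut \<Rightarrow> 'a neut \<Rightarrow> 'a neut" where
  "neut_mult f (Pure x) (Pure y) = Pure (f x y)"
| "neut_mult f (Pure x) (Indet y) = Indet (f x y)"
| "neut_mult f (Indet x) (Pure y) = Indet (f x y)"
| "neut_mult f (Indet x) (Indet y) = Indet (f x y)"

definition neutrosophic :: "'a monoid \<Rightarrow> 'a neut monoid" where
  "neutrosophic L =
     \<lparr>carrier = Pure ` carrier L \<union> Indet ` carrier L,
      monoid.mult = neut_mult (monoid.mult L),
      one = Pure (one L)\<rparr>"

definition neutrosophic_class :: "int \<Rightarrow> loop_elem neut monoid set" where
  "neutrosophic_class n =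
     {neutrosophic (L_loop n m) | m. 0 < m \<and> m < n \<and> gcd m n = 1 \<and> gcd (m - 1) n = 1}"

definition right_alternative :: "'a monoid \<Rightarrow> bool" where
  "right_alternative G \<longleftrightarrow>
     (\<forall>x\<in>carrier G. \<forall>y\<in>carrier G.
        (x \<otimes>\<^bsub>G\<^esub> y) \<otimes>\<^bsub>G\<^esub> y = x \<otimes>\<^bsub>G\<^esub> (y \<otimes>\<^bsub>G\<^esub> y))"

definition left_alternative :: "'a monoid \<Rightarrow> bool" where
  "left_alternative G \<longleftrightarrow>
     (\<forall>x\<in>carrier G. \<forall>y\<in>carrier G.
        (x \<otimes>\<^bsub>G\<^esub> x) \<otimes>\<^bsub>G\<^esub> y = x \<otimes>\<^bsub>G\<^esub> (x \<otimes>\<^bsub>G\<^esub> y))"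

definition alternative :: "'a monoid \<Rightarrow> bool" where
  "alternative G \<longleftrightarrow> left_alternative G \<and> right_alternative G"

lemma L_mult_well_defined:
  fixes n a :: int
  assumes "n > 0"
  shows "\<exists>!s. s \<in> {1..n} \<and> [s = a] (mod n)"
proof (rule ex1I)
  show "(a - 1) mod n + 1 \<in> {1..n} \<and> [(a - 1) mod n + 1 = a] (mod n)"
    using assms by (auto simp: cong_def mod_simps add1_zle_eq)
next
  fix s assume s: "s \<in> {1..n} \<and> [s = a] (mod n)"
  then have "(s - 1) mod n = (a - 1) mod n"
    by (metis cong_def cong_diff cong_refl)
  moreover have "(s - 1) mod n = s - 1" using s by simp
  ultimately show "s = (a - 1) mod n + 1" by simp
qed

text \<open>Counting members of the class is the same as counting admissible \<open>m\<close>:\<close>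

lemma neutrosophic_L_loop_inj:
  assumes "0 < m" "m < n" "0 < m'" "m' < n"
    and "neutrosophic (L_loop n m) = neutrosophic (L_loop n m')"
  shows "m = m'"
proof -
  have val: "(THE s. s \<in> {1..n} \<and> [s = k * 2 - (k - 1) * 1] (mod n)) = k + 1"
    if "0 < k" "k < n" for k
    by (rule the1_equality[OF L_mult_well_defined]) (use that in \<open>auto simp: algebra_simps\<close>)
  have "neut_mult (L_mult n m) (Pure (Num 1)) (Pure (Num 2)) =
        neut_mult (L_mult n m') (Pure (Num 1)) (Pure (Num 2))"
    using assms(5) by (simp add: neutrosophic_def L_loop_def)
  then show ?thesis
    using val[of m] val[of m'] assms by simp
qed

end

theory Submission imports Defs begin

text \<open>
  In \<open>L_n(m)\<close> left multiplication by \<open>i\<close> is the affine map \<open>j \<mapsto> i + m (j - i)\<close> modulo \<open>n\<close>, a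
  dilation with centre \<open>i\<close> and ratio \<open>m\<close>. Since \<open>i \<cdot> i = e\<close>, the left alternative law says that
  every left multiplication is an involution, that is, \<open>m\<^sup>2 \<equiv> 1\<close> modulo \<open>n\<close>. As \<open>m - 1\<close> is a unit
  modulo \<open>n\<close>, this means \<open>m \<equiv> -1\<close>, so \<open>m = n - 1\<close>; this parameter is admissible because \<open>n\<close> is odd.

  Right alternativity needs no separate computation: reversing the product of \<open>L_n(m)\<close> gives
  \<open>L_n(1 - m)\<close>, so the condition becomes \<open>1 - m \<equiv> -1\<close>, that is, \<open>m = 2\<close>. The two parameters
  \<open>n - 1\<close> and \<open>2\<close> differ because \<open>n > 3\<close>, hence no member of the class is alternative.

  Adjoining the indeterminate \<open>I\<close> changes nothing: both sides of either law contain the same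
  variables, so both carry the symbol \<open>I\<close> or neither does.
\<close>

lemma cong_imp_eq_in_interval:
  fixes n i j :: int
  assumes "i \<in> {1..n}" "j \<in> {1..n}" "[i = j] (mod n)"
  shows "i = j"
  using L_mult_well_defined[of n j] assms by (auto simp: cong_refl)

lemma L_mult_Num:
  assumes "n > 0" "i \<noteq> j"
  obtains s where "L_mult n m (Num i) (Num j) = Num s" "s \<in> {1..n}"
    "[s = m * j - (m - 1) * i] (mod n)"
  using theI'[OF L_mult_well_defined[OF assms(1), of "m * j - (m - 1) * i"]] assms(2) that
  by simp

lemma L_mult_E_right [simp]: "L_mult n m x E = x"
  by (cases x) simp_all

lemma L_mult_self [simp]: "L_mult n m x x = E"
  by (cases x) simp_all

text \<open>
  From here on products of two numbered elements are handled through their congruence, not by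
  unfolding the definite description.
\<close>

declare L_mult.simps(3) [simp del]

text \<open>
  The ratio of the dilation is squared when it is applied twice. Coprimality of \<open>m\<close> and \<open>n\<close> keeps
  the intermediate point away from the centre, where the product would be \<open>e\<close> instead.
\<close>

lemma L_mult_twice:
  assumes "n > 0" "coprime m n" "i \<in> {1..n}" "j \<in> {1..n}" "i \<noteq> j"
  obtains t where "L_mult n m (Num i) (L_mult n m (Num i) (Num j)) = Num t" "t \<in> {1..n}"
    "[t - i = m\<^sup>2 * (j - i)] (mod n)"
proof -
  obtain s where s: "L_mult n m (Num i) (Num j) = Num s" "s \<in> {1..n}"
      "[s = m * j - (m - 1) * i] (mod n)"
    using L_mult_Num[OF assms(1,5)] by blast
  have s_dil: "[s - i = m * (j - i)] (mod n)"
    using cong_diff[OF s(3) cong_refl[of i]] by (simp add: algebra_simps)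
  have "i \<noteq> s"
  proof
    assume "i = s"
    then have "n dvd m * (j - i)"
      using s_dil by (simp add: cong_iff_dvd_diff)
    then have "[j = i] (mod n)"
      using assms(2) by (simp add: coprime_commute coprime_dvd_mult_right_iff cong_iff_dvd_diff)
    then show False using cong_imp_eq_in_interval assms(3-5) by blast
  qed
  then obtain t where t: "L_mult n m (Num i) (Num s) = Num t" "t \<in> {1..n}"
      "[t = m * s - (m - 1) * i] (mod n)"
    using L_mult_Num[OF assms(1)] by blast
  have "[t - i = m * (s - i)] (mod n)"
    using cong_diff[OF t(3) cong_refl[of i]] by (simp add: algebra_simps)
  also have "[m * (s - i) = m * (m * (j - i))] (mod n)"
    using s_dil by (rule cong_scalar_left)
  finally show thesis
    using that s(1) t(1,2) by (simp add: power2_eq_square mult.assoc)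
qed

lemma left_alternative_L_loop_iff:
  assumes "n > 1" "coprime m n"
  shows "left_alternative (L_loop n m) \<longleftrightarrow> [m\<^sup>2 = 1] (mod n)"
proof
  assume L: "left_alternative (L_loop n m)"
  have mem: "1 \<in> {1..n}" "2 \<in> {1..n}" using assms(1) by auto
  \<comment> \<open>Since \<open>2 - 1 = 1\<close>, this single instance of the law already determines the ratio.\<close>
  have "L_mult n m (Num 1) (L_mult n m (Num 1) (Num 2)) = Num 2"
    using L[unfolded left_alternative_def, rule_format, of "Num 1" "Num 2"] mem
    by (simp add: L_loop_def)
  moreover obtain t where "L_mult n m (Num 1) (L_mult n m (Num 1) (Num 2)) = Num t"
      "[t - 1 = m\<^sup>2 * (2 - 1)] (mod n)"
    using L_mult_twice[of n m 1 2] assms mem by auto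
  ultimately have "[1 = m\<^sup>2] (mod n)" by simp
  then show "[m\<^sup>2 = 1] (mod n)" by (rule cong_sym)
next
  assume sq: "[m\<^sup>2 = 1] (mod n)"
  have involution: "L_mult n m (Num i) (L_mult n m (Num i) (Num j)) = Num j"
    if ij: "i \<in> {1..n}" "j \<in> {1..n}" for i j
  proof (cases "i = j")
    case False
    obtain t where t: "L_mult n m (Num i) (L_mult n m (Num i) (Num j)) = Num t" "t \<in> {1..n}"
        "[t - i = m\<^sup>2 * (j - i)] (mod n)"
      using L_mult_twice[of n m i j] assms ij False by auto
    have "[t - i = 1 * (j - i)] (mod n)"
      using t(3) cong_scalar_right[OF sq] by (rule cong_trans)
    then have "[t = j] (mod n)"
      by (simp add: cong_iff_dvd_diff)
    then show ?thesis
      using cong_imp_eq_in_interval t(1,2) ij(2) by blast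
  qed simp
  then show "left_alternative (L_loop n m)"
    by (auto simp: left_alternative_def L_loop_def)
qed

text \<open>
  The coefficients of \<open>j\<close> and \<open>i\<close> in \<open>m j + (1 - m) i\<close> add up to \<open>1\<close>, so exchanging the two factors
  amounts to replacing \<open>m\<close> by \<open>1 - m\<close>.
\<close>

lemma L_mult_opposite: "L_mult n m y x = L_mult n (1 - m) x y"
  by (cases x; cases y) (auto simp: L_mult.simps(3) algebra_simps)

lemma right_alternative_L_loop_iff:
  "right_alternative (L_loop n m) \<longleftrightarrow> left_alternative (L_loop n (1 - m))"
proof -
  have "L_mult n (1 - m) x y = L_mult n m y x" for x y
    by (rule L_mult_opposite[symmetric])
  then show ?thesis
    by (auto simp: right_alternative_def left_alternative_def L_loop_def)
qed

lemma left_alternative_neutrosophic_iff: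
  "left_alternative (neutrosophic L) \<longleftrightarrow> left_alternative L"
  by (auto simp: left_alternative_def neutrosophic_def ball_Un)

lemma right_alternative_neutrosophic_iff:
  "right_alternative (neutrosophic L) \<longleftrightarrow> right_alternative L"
  by (auto simp: right_alternative_def neutrosophic_def ball_Un)

text \<open>
  Modulo \<open>n\<close> the factorization \<open>k\<^sup>2 - 1 = (k - 1) (k + 1)\<close> leaves only the root \<open>-1\<close> when
  \<open>k - 1\<close> is a unit.
\<close>

lemma square_cong_one_iff:
  fixes k n :: int
  assumes "coprime (k - 1) n"
  shows "[k\<^sup>2 = 1] (mod n) \<longleftrightarrow> n dvd k + 1"
proof -
  have "k\<^sup>2 - 1 = (k - 1) * (k + 1)" by (simp add: power2_eq_square algebra_simps)
  then show ?thesis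
    using assms by (simp add: cong_iff_dvd_diff coprime_commute coprime_dvd_mult_right_iff)
qed

lemma left_alternative_neutrosophic_L_loop_iff:
  assumes "0 < m" "m < n" "coprime m n" "coprime (m - 1) n"
  shows "left_alternative (neutrosophic (L_loop n m)) \<longleftrightarrow> m = n - 1"
proof -
  have "left_alternative (neutrosophic (L_loop n m)) \<longleftrightarrow> n dvd m + 1"
    using assms
    by (simp add: left_alternative_neutrosophic_iff left_alternative_L_loop_iff
        square_cong_one_iff)
  also have "\<dots> \<longleftrightarrow> m = n - 1"
    using assms(1,2) zdvd_imp_le[of n "m + 1"] by auto
  finally show ?thesis .
qed

lemma right_alternative_neutrosophic_L_loop_iff:
  assumes "n > 2" "0 < m" "m < n" "coprime m n" "coprime (m - 1) n"
  shows "right_alternative (neutrosophic (L_loop n m)) \<longleftrightarrow> m = 2"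
proof -
  have cop: "coprime (1 - m) n" "coprime (1 - m - 1) n"
    using assms(4,5) coprime_minus_left_iff[of "m - 1" n] coprime_minus_left_iff[of m n]
    by simp_all
  have "right_alternative (neutrosophic (L_loop n m)) \<longleftrightarrow> n dvd 1 - m + 1"
    using assms(2,3) cop
    by (simp only: right_alternative_neutrosophic_iff right_alternative_L_loop_iff
        left_alternative_L_loop_iff square_cong_one_iff)
  also have "\<dots> \<longleftrightarrow> n dvd m - 2"
    using dvd_minus_iff[of n "m - 2"] by simp
  also have "\<dots> \<longleftrightarrow> m = 2"
  \<comment> \<open>The difference \<open>m - 2\<close> lies in \<open>{-1..<n}\<close>, and \<open>n\<close> does not divide \<open>-1\<close>.\<close>
  proof
    assume "n dvd m - 2"
    then have "\<not> 2 < m" and "m \<noteq> 1"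
      using assms(1-3) zdvd_imp_le[of n "m - 2"] by auto
    then show "m = 2"
      using assms(2) by linarith
  qed simp
  finally show ?thesis .
qed

lemma ex1_neutrosophic_class:
  assumes "0 < k" "k < n" "coprime k n" "coprime (k - 1) n"
    and "\<And>m. \<lbrakk>0 < m; m < n; coprime m n; coprime (m - 1) n\<rbrakk>
      \<Longrightarrow> P (neutrosophic (L_loop n m)) \<longleftrightarrow> m = k"
  shows "\<exists>!L. L \<in> neutrosophic_class n \<and> P L"
proof (rule ex1I)
  show "neutrosophic (L_loop n k) \<in> neutrosophic_class n \<and> P (neutrosophic (L_loop n k))"
    using assms by (auto simp: neutrosophic_class_def coprime_iff_gcd_eq_1)
  show "L = neutrosophic (L_loop n k)" if "L \<in> neutrosophic_class n \<and> P L" for L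
    using that assms(5) by (auto simp: neutrosophic_class_def coprime_iff_gcd_eq_1)
qed

theorem theorem4p1p9:
  fixes n :: int
  assumes "n > 3" and "odd n"
  shows "(\<exists>!L. L \<in> neutrosophic_class n \<and> left_alternative L) \<and>
         (\<exists>!L. L \<in> neutrosophic_class n \<and> right_alternative L) \<and>
         \<not> (\<exists>L. L \<in> neutrosophic_class n \<and> alternative L)"
proof (intro conjI)
  have cop2: "coprime 2 n" using assms(2) by simp
  have cop: "coprime (n - 1) n" by (rule coprime_diff_one_left)
  have "coprime (n - 2) n"
    using cop2 by (simp only: coprime_iff_gcd_eq_1 gcd_diff2)
  then have cop': "coprime (n - 1 - 1) n" by simp
  show "\<exists>!L. L \<in> neutrosophic_class n \<and> left_alternative L"
    using assms(1) cop cop'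
    by (intro ex1_neutrosophic_class[of "n - 1"] left_alternative_neutrosophic_L_loop_iff) auto
  show "\<exists>!L. L \<in> neutrosophic_class n \<and> right_alternative L"
    using assms(1) cop2
    by (intro ex1_neutrosophic_class[of 2] right_alternative_neutrosophic_L_loop_iff) auto
  show "\<not> (\<exists>L. L \<in> neutrosophic_class n \<and> alternative L)"
    using assms(1) left_alternative_neutrosophic_L_loop_iff[of _ n]
      right_alternative_neutrosophic_L_loop_iff[of n]
    by (fastforce simp: neutrosophic_class_def alternative_def coprime_iff_gcd_eq_1)
qed

end
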